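(* Suppose that every cubic $2$-edge-connected graph has a set of six perfect matchings such that every edge is contained in exactly two of them (the Berge–Fulkerson conjecture). Then every $3$-edge-connected graph $G$ satisfies $f(G)\leq 5$.
   Context: Graphs are finite and undirected; parallel edges are allowed. For a graph $G=(V,E)$ and $X\subseteq V$, $\delta_G(X)$ is the set of edges with exactly one endvertex in $X$, and $G$ is $k$-edge-connected if $|\delta_G(X)|\ge k$ for every nonempty proper subset $X$ of $V$. A graph is cubic if every vertex has degree $3$. An orientation of $G$ replaces each edge $uv$ by exactly one of the arcs $uv$ or $vu$; for $e\in E$, $\vec e$ denotes the corresponding arc. A digraph is strongly connected if for every nonempty proper vertex subset $X$ some arc leaves $X$. For a $3$-edge-connected graph $G$, the Frank number $f(G)$ is the minimum integer $k$ such that there exist $k$ orientations $D_1,\dots,D_k$ of $G$ with the property that for every edge $e$ of $G$ there is an $i$ with $D_i-\vec e$ strongly connected. *)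

theory Defs
  imports "Graph_Theory.Digraph_Component" "HOL-Library.Extended_Nat"
begin

record ('v, 'e) mgraph =
  vertices :: "'v set"
  edges :: "'e set"
  ends :: "'e \<Rightarrow> 'v set"

text \<open>
  Edges are named, so parallel edges are distinct names with the same set of ends.
  Every edge has two distinct ends: there are no loops.
\<close>

locale multigraph =
  fixes G :: "('v, 'e) mgraph"
  assumes finite_vertices: "finite (vertices G)"
    and finite_edges: "finite (edges G)"
    and ends_subset: "e \<in> edges G \<Longrightarrow> ends G e \<subseteq> vertices G"
    and card_ends: "e \<in> edges G \<Longrightarrow> card (ends G e) = 2"

definition cut_edges :: "('v, 'e) mgraph \<Rightarrow> 'v set \<Rightarrow> 'e set" where
  "cut_edges G X = {e \<in> edges G. card (ends G e \<inter> X) = 1}"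

definition k_edge_connected :: "nat \<Rightarrow> ('v, 'e) mgraph \<Rightarrow> bool" where
  "k_edge_connected k G \<longleftrightarrow>
    (\<forall>X. X \<noteq> {} \<and> X \<subset> vertices G \<longrightarrow> k \<le> card (cut_edges G X))"

definition degree :: "('v, 'e) mgraph \<Rightarrow> 'v \<Rightarrow> nat" where
  "degree G v = card {e \<in> edges G. v \<in> ends G e}"

definition cubic :: "('v, 'e) mgraph \<Rightarrow> bool" where
  "cubic G \<longleftrightarrow> (\<forall>v \<in> vertices G. degree G v = 3)"

definition perfect_matching :: "('v, 'e) mgraph \<Rightarrow> 'e set \<Rightarrow> bool" where
  "perfect_matching G M \<longleftrightarrow>
    M \<subseteq> edges G \<and> (\<forall>v \<in> vertices G. \<exists>!e. e \<in> M \<and> v \<in> ends G e)"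

text \<open>
  The six perfect matchings are an indexed family, so repetitions are allowed. This is
  needed: the graph with two vertices and three parallel edges has only three perfect
  matchings, as has \<open>K\<^sub>4\<close>.
\<close>

definition has_berge_fulkerson_cover :: "('v, 'e) mgraph \<Rightarrow> bool" where
  "has_berge_fulkerson_cover G \<longleftrightarrow>
    (\<exists>M :: nat \<Rightarrow> 'e set.
      (\<forall>i < 6. perfect_matching G (M i)) \<and>
      (\<forall>e \<in> edges G. card {i. i < 6 \<and> e \<in> M i} = 2))"

text \<open>
  An orientation uses the edge names as arc names, so the arc arising from an edge \<open>e\<close>
  is again called \<open>e\<close>.
\<close>

definition orientation :: "('v, 'e) mgraph \<Rightarrow> ('v, 'e) pre_digraph \<Rightarrow> bool" where
  "orientation G D \<longleftrightarrow>
    verts D = vertices G \<and> arcs D = edges G \<and>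
    (\<forall>e \<in> edges G. {tail D e, head D e} = ends G e)"

definition strong :: "('v, 'e) pre_digraph \<Rightarrow> bool" where
  "strong D \<longleftrightarrow>
    (\<forall>X. X \<noteq> {} \<and> X \<subset> verts D \<longrightarrow>
      (\<exists>a \<in> arcs D. tail D a \<in> X \<and> head D a \<in> verts D - X))"

lemma (in wf_digraph) strong_iff_strongly_connected:
  assumes "verts G \<noteq> {}"
  shows "strong G \<longleftrightarrow> strongly_connected G"
proof
  assume strong: "strong G"
  have "u \<rightarrow>\<^sup>*\<^bsub>G\<^esub> v" if u: "u \<in> verts G" and v: "v \<in> verts G" for u v
  proof (rule ccontr)
    assume no: "\<not> u \<rightarrow>\<^sup>*\<^bsub>G\<^esub> v"
    define X where "X = {w \<in> verts G. u \<rightarrow>\<^sup>*\<^bsub>G\<^esub> w}"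
    have "u \<in> X" "v \<notin> X" "X \<subseteq> verts G"
      using u no by (auto simp: X_def)
    then have "X \<noteq> {}" "X \<subset> verts G"
      using v by auto
    then obtain a where a: "a \<in> arcs G" "tail G a \<in> X" "head G a \<in> verts G - X"
      using strong unfolding strong_def by blast
    then have "u \<rightarrow>\<^sup>*\<^bsub>G\<^esub> tail G a" "tail G a \<rightarrow>\<^bsub>G\<^esub> head G a"
      by (auto simp: X_def intro: in_arcs_imp_in_arcs_ends)
    then have "u \<rightarrow>\<^sup>*\<^bsub>G\<^esub> head G a"
      using reachable_adj_trans by blast
    then show False
      using a by (auto simp: X_def)
  qed
  then show "strongly_connected G"
    using assms by (simp add: strongly_connected_def)
next
  assume sc: "strongly_connected G"
  show "strong G"
    unfolding strong_def
  proof (intro allI impI)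
    fix X assume X: "X \<noteq> {} \<and> X \<subset> verts G"
    then obtain u v where uv: "u \<in> X" "v \<in> verts G" "v \<notin> X" by blast
    show "\<exists>a \<in> arcs G. tail G a \<in> X \<and> head G a \<in> verts G - X"
    proof (rule ccontr)
      assume closed: "\<not> ?thesis"
      have "u \<rightarrow>\<^sup>*\<^bsub>G\<^esub> v"
        using sc X uv by (auto simp: strongly_connected_def)
      then have "v \<in> X"
      proof (induct rule: reachable_induct)
        case base
        show ?case by (rule uv(1))
      next
        case (step x y)
        then show ?case using closed by (auto simp: arcs_ends_def arc_to_ends_def)
      qed
      then show False using uv by simp
    qed
  qed
qed

text \<open>
  The infimum is taken in \<open>enat\<close>, so that it would be \<open>\<infinity>\<close>, not an arbitrary number,
  if no suitable orientations existed.
\<close>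

definition frank_number :: "('v, 'e) mgraph \<Rightarrow> enat" where
  "frank_number G = Inf {enat k | k.
    \<exists>D :: nat \<Rightarrow> ('v, 'e) pre_digraph.
      (\<forall>i < k. orientation G (D i)) \<and>
      (\<forall>e \<in> edges G. \<exists>i < k. strong (pre_digraph.del_arc (D i) e))}"

end

theory Submission
  imports Defs
begin

text \<open>
  Inflating every vertex to a cycle gives a cubic bridgeless graph, whose Berge--Fulkerson cover
  restricts to sets \<open>M\<^sub>0, \<dots>, M\<^sub>5\<close> of edges of \<open>G\<close> that contain every edge exactly twice and
  whose complements \<open>C\<^sub>i\<close> are even subgraphs. By parity every 3-edge-cut meets each \<open>M\<^sub>i\<close> in exactly
  one edge.

  An integer flow orients the edges by its sign, and an edge that weighs less than the rest of every
  cut is deletable. Let \<open>s\<^sub>i\<close> be a flow with values \<open>\<plusminus>1\<close> on \<open>C\<^sub>i\<close> and 0 elsewhere, and let \<open>p\<^sub>i\<close> be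
  such a flow on the symmetric difference of \<open>C\<^sub>i\<^sub>+\<^sub>1\<close> and \<open>C\<^sub>5\<close>, where \<open>i < 5\<close> and \<open>i + 1\<close> is taken
  modulo 5. The flow \<open>F\<^sub>i = s\<^sub>5 + 2 p\<^sub>i + 5 s\<^sub>i\<close> vanishes nowhere, is at least 2 in absolute value on
  \<open>C\<^sub>i\<close>, and at most 2 on \<open>M\<^sub>i - M\<^sub>i\<^sub>+\<^sub>1\<close>. For an edge of the latter set the rest of a cut weighs at
  least 3: it has at least three edges, or two edges, both in \<open>C\<^sub>i\<close>. Finally every edge lies in
  \<open>M\<^sub>i - M\<^sub>i\<^sub>+\<^sub>1\<close> for some \<open>i < 5\<close>, as it lies in only two of the sets.
\<close>

section \<open>Flows with values plus or minus one on even edge sets\<close>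

text \<open>Tested against the indicator of a vertex, the hypothesis says that the vertex has even
  degree in \<open>C\<close>, and the conclusion that the flow is conserved there. The induction
  merges two consecutive edges into one and gives both the sign of the merged edge, up to direction.
  Merging can create loops and changes ends, so \<open>t\<close> and \<open>h\<close> are arbitrary
  functions not tied to a graph.\<close>

lemma eulerian_signs:
  fixes t h :: "'e \<Rightarrow> 'v"
  assumes "finite C"
    and "\<And>\<phi> :: 'v \<Rightarrow> int. even (\<Sum>e\<in>C. \<phi> (h e) - \<phi> (t e))"
  obtains s :: "'e \<Rightarrow> int"
  where "\<And>e. e \<in> C \<Longrightarrow> \<bar>s e\<bar> = 1" and "\<And>e. e \<notin> C \<Longrightarrow> s e = 0"
    and "\<And>\<phi> :: 'v \<Rightarrow> int. (\<Sum>e\<in>C. s e * (\<phi> (h e) - \<phi> (t e))) = 0"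
proof -
  have "\<exists>s :: 'e \<Rightarrow> int. (\<forall>e\<in>C. \<bar>s e\<bar> = 1) \<and>
      (\<forall>\<phi> :: 'v \<Rightarrow> int. (\<Sum>e\<in>C. s e * (\<phi> (h e) - \<phi> (t e))) = 0)"
    using assms
  proof (induction "card C" arbitrary: C t h)
    case 0
    then show ?case by simp
  next
    case (Suc n)
    from Suc.hyps(2) obtain e where e: "e \<in> C" by fastforce
    show ?case
    proof (cases "t e = h e")
      case True
      have sum_e: "(\<Sum>x\<in>C. s x * (\<phi> (h x) - \<phi> (t x))) =
          (\<Sum>x\<in>C - {e}. s x * (\<phi> (h x) - \<phi> (t x)))" for s :: "'e \<Rightarrow> int" and \<phi>
        using sum.remove[OF Suc.prems(1) e, of "\<lambda>x. s x * (\<phi> (h x) - \<phi> (t x))"] True by simp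
      have "\<exists>s :: 'e \<Rightarrow> int. (\<forall>x\<in>C - {e}. \<bar>s x\<bar> = 1) \<and>
          (\<forall>\<phi> :: 'v \<Rightarrow> int. (\<Sum>x\<in>C - {e}. s x * (\<phi> (h x) - \<phi> (t x))) = 0)"
      proof (rule Suc.hyps(1))
        show "n = card (C - {e})" using Suc.hyps(2) e by simp
        show "finite (C - {e})" using Suc.prems(1) by simp
        show "even (\<Sum>x\<in>C - {e}. \<phi> (h x) - \<phi> (t x))" for \<phi> :: "'v \<Rightarrow> int"
          using Suc.prems(2)[of \<phi>] sum_e[of "\<lambda>_. 1" \<phi>] by simp
      qed
      then obtain s :: "'e \<Rightarrow> int" where s: "\<forall>x\<in>C - {e}. \<bar>s x\<bar> = 1"
        "\<forall>\<phi> :: 'v \<Rightarrow> int. (\<Sum>x\<in>C - {e}. s x * (\<phi> (h x) - \<phi> (t x))) = 0" by blast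
      \<comment> \<open>A loop contributes 0 to every sum, so its sign is arbitrary.\<close>
      have "(\<Sum>x\<in>C. (s(e := 1)) x * (\<phi> (h x) - \<phi> (t x))) = 0" for \<phi> :: "'v \<Rightarrow> int"
      proof -
        have "(\<Sum>x\<in>C - {e}. (s(e := 1)) x * (\<phi> (h x) - \<phi> (t x))) =
            (\<Sum>x\<in>C - {e}. s x * (\<phi> (h x) - \<phi> (t x)))"
          by (rule sum.cong) auto
        then show ?thesis using sum_e[of "s(e := 1)" \<phi>] s(2) by simp
      qed
      then show ?thesis using s(1) by (intro exI[of _ "s(e := 1)"]) auto
    next
      case False
      \<comment> \<open>If no further edge met \<open>h e\<close>, the sum for the indicator of
        \<open>h e\<close> would be 1, which is odd.\<close>
      have "\<exists>f\<in>C - {e}. t f = h e \<or> h f = h e"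
      proof (rule ccontr)
        assume no: "\<not> ?thesis"
        define \<phi> :: "'v \<Rightarrow> int" where "\<phi> = (\<lambda>v. of_bool (v = h e))"
        have "(\<Sum>x\<in>C - {e}. \<phi> (h x) - \<phi> (t x)) = 0"
          using no by (intro sum.neutral) (auto simp: \<phi>_def)
        then have "(\<Sum>x\<in>C. \<phi> (h x) - \<phi> (t x)) = 1"
          using sum.remove[OF Suc.prems(1) e, of "\<lambda>x. \<phi> (h x) - \<phi> (t x)"] False
          by (simp add: \<phi>_def)
        then show False using Suc.prems(2)[of \<phi>] by simp
      qed
      then obtain f where f: "f \<in> C" "f \<noteq> e" "t f = h e \<or> h f = h e" by blast
      txt \<open>
        The consecutive edges \<open>e\<close>, \<open>f\<close> are merged into one edge; \<open>\<epsilon>\<close> is the sign with which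
        \<open>f\<close> is traversed, and \<open>z\<close> its far end.
      \<close>
      define z where "z = (if t f = h e then h f else t f)"
      define \<epsilon> :: int where "\<epsilon> = (if t f = h e then 1 else - 1)"
      define h' where "h' = h(e := z)"
      have merge: "\<epsilon> * (\<phi> (h f) - \<phi> (t f)) = \<phi> z - \<phi> (h e)" for \<phi> :: "'v \<Rightarrow> int"
        using f(3) by (auto simp: z_def \<epsilon>_def)
      have fin: "finite (C - {f} - {e})" using Suc.prems(1) by simp
      have sum_ef: "(\<Sum>x\<in>C. g x) = g e + g f + (\<Sum>x\<in>C - {f} - {e}. g x)" for g :: "'e \<Rightarrow> int"
        using sum.remove[OF Suc.prems(1) f(1), of g] sum.remove[of "C - {f}" e g] e f Suc.prems(1)
        by simp
      have sum_e: "(\<Sum>x\<in>C - {f}. g x) = g e + (\<Sum>x\<in>C - {f} - {e}. g x)" for g :: "'e \<Rightarrow> int"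
        using sum.remove[of "C - {f}" e g] e f Suc.prems(1) by simp
      have rest: "(\<Sum>x\<in>C - {f} - {e}. s x * (\<phi> (h' x) - \<phi> (t x))) =
          (\<Sum>x\<in>C - {f} - {e}. s x * (\<phi> (h x) - \<phi> (t x)))"
        for s :: "'e \<Rightarrow> int" and \<phi>
        by (rule sum.cong) (auto simp: h'_def)
      have "\<exists>s :: 'e \<Rightarrow> int. (\<forall>x\<in>C - {f}. \<bar>s x\<bar> = 1) \<and>
          (\<forall>\<phi> :: 'v \<Rightarrow> int. (\<Sum>x\<in>C - {f}. s x * (\<phi> (h' x) - \<phi> (t x))) = 0)"
      proof (rule Suc.hyps(1))
        show "n = card (C - {f})" using Suc.hyps(2) f(1) by simp
        show "finite (C - {f})" using Suc.prems(1) by simp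
        fix \<phi> :: "'v \<Rightarrow> int"
        \<comment> \<open>Merging alters the sum only where \<open>f\<close> is traversed backwards,
          and then by twice the term of \<open>f\<close>.\<close>
        have "(\<Sum>x\<in>C - {f}. \<phi> (h' x) - \<phi> (t x)) =
            (\<Sum>x\<in>C. \<phi> (h x) - \<phi> (t x)) + (\<epsilon> - 1) * (\<phi> (h f) - \<phi> (t f))"
          using rest[of "\<lambda>_. 1" \<phi>] merge[of \<phi>]
          by (simp add: sum_ef sum_e h'_def left_diff_distrib)
        moreover have "even (\<epsilon> - 1)" by (simp add: \<epsilon>_def)
        ultimately show "even (\<Sum>x\<in>C - {f}. \<phi> (h' x) - \<phi> (t x))"
          using Suc.prems(2)[of \<phi>] by simp
      qed
      then obtain s :: "'e \<Rightarrow> int" where s: "\<forall>x\<in>C - {f}. \<bar>s x\<bar> = 1"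
        "\<forall>\<phi> :: 'v \<Rightarrow> int. (\<Sum>x\<in>C - {f}. s x * (\<phi> (h' x) - \<phi> (t x))) = 0" by blast
      define s' where "s' = s(f := s e * \<epsilon>)"
      have "(\<Sum>x\<in>C. s' x * (\<phi> (h x) - \<phi> (t x))) = 0" for \<phi> :: "'v \<Rightarrow> int"
      proof -
        have "(\<Sum>x\<in>C - {f} - {e}. s' x * (\<phi> (h x) - \<phi> (t x))) =
            (\<Sum>x\<in>C - {f} - {e}. s x * (\<phi> (h x) - \<phi> (t x)))"
          by (rule sum.cong) (auto simp: s'_def)
        then have "(\<Sum>x\<in>C. s' x * (\<phi> (h x) - \<phi> (t x))) =
            s e * (\<phi> (h e) - \<phi> (t e)) + s e * (\<epsilon> * (\<phi> (h f) - \<phi> (t f))) +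
            (\<Sum>x\<in>C - {f} - {e}. s x * (\<phi> (h' x) - \<phi> (t x)))"
          using f(2) by (simp add: sum_ef rest s'_def)
        also have "\<dots> = (\<Sum>x\<in>C - {f}. s x * (\<phi> (h' x) - \<phi> (t x)))"
          by (simp add: sum_e merge h'_def flip: distrib_left)
        finally show ?thesis using s(2) by simp
      qed
      moreover have "\<forall>x\<in>C. \<bar>s' x\<bar> = 1"
        using s(1) e f(2) by (auto simp: s'_def \<epsilon>_def abs_mult)
      ultimately show ?thesis by blast
    qed
  qed
  then obtain s :: "'e \<Rightarrow> int" where s: "\<forall>e\<in>C. \<bar>s e\<bar> = 1"
    "\<forall>\<phi> :: 'v \<Rightarrow> int. (\<Sum>e\<in>C. s e * (\<phi> (h e) - \<phi> (t e))) = 0" by blast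
  have "(\<Sum>e\<in>C. (if e \<in> C then s e else 0) * (\<phi> (h e) - \<phi> (t e))) = 0" for \<phi> :: "'v \<Rightarrow> int"
    using s(2) by (simp cong: sum.cong)
  then show thesis using s(1) by (intro that[of "\<lambda>e. if e \<in> C then s e else 0"]) auto
qed

section \<open>Independence of the conjecture from the types of vertices and edges\<close>

text \<open>A hypothesis cannot quantify over types, so the conjecture is assumed for names in
  \<open>nat\<close> only. A finite graph is copied there along injections, and the matchings of the
  copy are pulled back.\<close>

lemma berge_fulkerson_any_type:
  fixes H :: "('v, 'e) mgraph"
  assumes berge_fulkerson:
      "\<And>H :: (nat, nat) mgraph.
        multigraph H \<Longrightarrow> cubic H \<Longrightarrow> k_edge_connected 2 H \<Longrightarrow> has_berge_fulkerson_cover H"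
    and H: "multigraph H" "cubic H" "k_edge_connected 2 H"
  shows "has_berge_fulkerson_cover H"
proof -
  interpret multigraph H by (rule H(1))
  obtain f :: "'v \<Rightarrow> nat" where f: "inj_on f (vertices H)"
    using finite_imp_inj_to_nat_seg[OF finite_vertices] by blast
  obtain g :: "'e \<Rightarrow> nat" where g: "inj_on g (edges H)"
    using finite_imp_inj_to_nat_seg[OF finite_edges] by blast
  define H' where "H' = \<lparr>vertices = f ` vertices H, edges = g ` edges H,
    ends = \<lambda>n. f ` ends H (the_inv_into (edges H) g n)\<rparr>"
  have V': "vertices H' = f ` vertices H" and E': "edges H' = g ` edges H"
    by (simp_all add: H'_def)
  have ends': "ends H' (g e) = f ` ends H e" if "e \<in> edges H" for e
    using that g by (simp add: H'_def the_inv_into_f_f)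
  have mem: "f v \<in> ends H' (g e) \<longleftrightarrow> v \<in> ends H e" if "e \<in> edges H" "v \<in> vertices H" for e v
    using inj_on_image_mem_iff[OF f that(2) ends_subset] that ends' by simp
  have card_inter: "card (ends H' (g e) \<inter> f ` X) = card (ends H e \<inter> X)"
    if "e \<in> edges H" "X \<subseteq> vertices H" for e X
  proof -
    have "ends H' (g e) \<inter> f ` X = f ` (ends H e \<inter> X)"
      using that ends' inj_on_image_Int[OF f ends_subset] by simp
    moreover have "inj_on f (ends H e \<inter> X)"
      using that(2) by (intro inj_on_subset[OF f]) auto
    ultimately show ?thesis by (simp add: card_image)
  qed
  have mg: "multigraph H'"
  proof
    show "finite (vertices H')" "finite (edges H')"
      by (simp_all add: V' E' finite_vertices finite_edges)
    fix n assume "n \<in> edges H'"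
    then obtain e where e: "e \<in> edges H" "n = g e" by (auto simp: E')
    show "ends H' n \<subseteq> vertices H'"
      using e ends_subset by (auto simp: ends' V')
    show "card (ends H' n) = 2"
      using e inj_on_subset[OF f ends_subset] by (simp add: ends' card_image card_ends)
  qed
  have cubic: "cubic H'"
    unfolding cubic_def
  proof
    fix n assume "n \<in> vertices H'"
    then obtain v where v: "v \<in> vertices H" "n = f v" by (auto simp: V')
    have "{x \<in> edges H'. n \<in> ends H' x} = g ` {e \<in> edges H. v \<in> ends H e}"
      using v mem by (auto simp: E')
    moreover have "inj_on g {e \<in> edges H. v \<in> ends H e}"
      by (rule inj_on_subset[OF g]) auto
    ultimately show "degree H' n = 3"
      using H(2) v by (simp add: degree_def cubic_def card_image)
  qed
  have conn: "k_edge_connected 2 H'"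
    unfolding k_edge_connected_def
  proof (intro allI impI)
    fix Y assume Y: "Y \<noteq> {} \<and> Y \<subset> vertices H'"
    define X where "X = {v \<in> vertices H. f v \<in> Y}"
    have YX: "Y = f ` X" using Y by (auto simp: X_def V')
    have XV: "X \<subseteq> vertices H" by (auto simp: X_def)
    have "X \<noteq> {}" "X \<noteq> vertices H" using Y YX V' by auto
    with XV have X: "X \<noteq> {} \<and> X \<subset> vertices H" by blast
    have "cut_edges H' Y = g ` cut_edges H X"
    proof -
      have "g e \<in> cut_edges H' Y \<longleftrightarrow> e \<in> cut_edges H X" if "e \<in> edges H" for e
        using card_inter[OF that XV] that by (simp add: cut_edges_def YX E')
      moreover have "cut_edges H' Y \<subseteq> g ` edges H" "cut_edges H X \<subseteq> edges H"
        by (auto simp: cut_edges_def E')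
      ultimately show ?thesis by blast
    qed
    moreover have "inj_on g (cut_edges H X)"
      by (rule inj_on_subset[OF g]) (auto simp: cut_edges_def)
    ultimately show "2 \<le> card (cut_edges H' Y)"
      using H(3) X by (simp add: k_edge_connected_def card_image)
  qed
  from berge_fulkerson[OF mg cubic conn] obtain M :: "nat \<Rightarrow> nat set" where
    pm: "\<forall>i<6. perfect_matching H' (M i)" and
    two: "\<forall>e\<in>edges H'. card {i. i < 6 \<and> e \<in> M i} = 2"
    unfolding has_berge_fulkerson_cover_def by blast
  define N where "N i = {e \<in> edges H. g e \<in> M i}" for i :: nat
  have "perfect_matching H (N i)" if "i < 6" for i
    unfolding perfect_matching_def
  proof (intro conjI ballI)
    show "N i \<subseteq> edges H" by (auto simp: N_def)
    fix v assume v: "v \<in> vertices H"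
    from pm that v have ex1: "\<exists>!n. n \<in> M i \<and> f v \<in> ends H' n" and sub: "M i \<subseteq> g ` edges H"
      by (auto simp: perfect_matching_def V' E')
    from ex1 obtain n where n: "n \<in> M i" "f v \<in> ends H' n" by blast
    with sub obtain e where e: "e \<in> edges H" "n = g e" by blast
    show "\<exists>!e. e \<in> N i \<and> v \<in> ends H e"
    proof
      show "e \<in> N i \<and> v \<in> ends H e" using n e v by (simp add: N_def mem)
      fix e' assume "e' \<in> N i \<and> v \<in> ends H e'"
      then have "e' \<in> edges H" "g e' \<in> M i" "f v \<in> ends H' (g e')"
        using v by (auto simp: N_def mem)
      with ex1 n e show "e' = e" by (metis g inj_onD)
    qed
  qed
  moreover have "card {i. i < 6 \<and> e \<in> N i} = 2" if "e \<in> edges H" for e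
    using two that by (simp add: N_def E')
  ultimately show ?thesis
    unfolding has_berge_fulkerson_cover_def by blast
qed

section \<open>Inflation of a graph to a cubic graph\<close>

definition star :: "('v, 'e) mgraph \<Rightarrow> 'v \<Rightarrow> 'e set" where
  "star G v = {e \<in> edges G. v \<in> ends G e}"

text \<open>The second conjunct makes the permutation a single cycle, in the form needed for cuts:
  it leads out of every nonempty proper subset.\<close>

definition cyclic_permutation :: "'a set \<Rightarrow> ('a \<Rightarrow> 'a) \<Rightarrow> bool" where
  "cyclic_permutation A \<sigma> \<longleftrightarrow> bij_betw \<sigma> A A \<and>
    (\<forall>B. B \<noteq> {} \<and> B \<subseteq> A \<and> \<sigma> ` B \<subseteq> B \<longrightarrow> B = A)"

text \<open>A new element \<open>a\<close> is spliced into a cycle behind some \<open>b\<close>: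
  \<open>b\<close> is sent to \<open>a\<close>, and \<open>a\<close> to the old successor of
  \<open>b\<close>.\<close>

lemma cyclic_permutation_exists:
  assumes "finite A"
  shows "\<exists>\<sigma>. cyclic_permutation A \<sigma>"
  using assms
proof (induction A rule: finite_induct)
  case empty
  show ?case by (auto simp: cyclic_permutation_def)
next
  case (insert a A)
  show ?case
  proof (cases "A = {}")
    case True
    then show ?thesis
      by (intro exI[of _ id]) (auto simp: cyclic_permutation_def)
  next
    case False
    then obtain b where b: "b \<in> A" by blast
    from insert.IH obtain \<sigma> where \<sigma>: "bij_betw \<sigma> A A"
      and orbit: "\<And>B. B \<noteq> {} \<Longrightarrow> B \<subseteq> A \<Longrightarrow> \<sigma> ` B \<subseteq> B \<Longrightarrow> B = A"
      by (auto simp: cyclic_permutation_def)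
    have \<sigma>A: "\<sigma> x \<in> A" if "x \<in> A" for x using \<sigma> that by (auto simp: bij_betw_def)
    define \<sigma>' where "\<sigma>' = \<sigma>(a := \<sigma> b, b := a)"
    have ab: "a \<noteq> b" using b insert.hyps by auto
    have "y \<in> \<sigma>' ` insert a A" if y: "y \<in> insert a A" for y
    proof (cases "y = a")
      case True
      then have "y = \<sigma>' b" by (simp add: \<sigma>'_def)
      then show ?thesis using b by blast
    next
      case False
      with y \<sigma> obtain x where x: "x \<in> A" "y = \<sigma> x" by (auto simp: bij_betw_def)
      then have "y = \<sigma>' (if x = b then a else x)"
        using ab insert.hyps by (auto simp: \<sigma>'_def)
      then show ?thesis using x by auto
    qed
    then have surj: "insert a A \<subseteq> \<sigma>' ` insert a A" by blast
    then have "inj_on \<sigma>' (insert a A)"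
      using insert.hyps(1) by (intro finite_surj_inj) auto
    moreover have "\<sigma>' ` insert a A \<subseteq> insert a A"
      using b \<sigma>A by (auto simp: \<sigma>'_def)
    ultimately have "bij_betw \<sigma>' (insert a A) (insert a A)"
      using surj by (auto simp: bij_betw_def)
    moreover have "B = insert a A" if B: "B \<noteq> {}" "B \<subseteq> insert a A" "\<sigma>' ` B \<subseteq> B" for B
    proof -
      have closed: "\<sigma> x \<in> B \<inter> A" if "x \<in> B \<inter> A" for x
      proof (cases "x = b")
        case True
        then have "\<sigma>' b \<in> B" using B(3) that by blast
        then have "a \<in> B" by (simp add: \<sigma>'_def)
        then have "\<sigma>' a \<in> B" using B(3) by blast
        then show ?thesis using True b ab \<sigma>A by (simp add: \<sigma>'_def)
      next
        case False
        moreover have "x \<noteq> a" using that insert.hyps by auto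
        moreover have "\<sigma>' x \<in> B" using B(3) that by blast
        ultimately show ?thesis using that \<sigma>A by (simp add: \<sigma>'_def)
      qed
      have "B \<inter> A \<noteq> {}"
      proof
        assume "B \<inter> A = {}"
        then have "a \<in> B" using B by blast
        then have "\<sigma>' a \<in> B" using B(3) by blast
        then show False using \<open>B \<inter> A = {}\<close> b ab \<sigma>A by (auto simp: \<sigma>'_def)
      qed
      then have "B \<inter> A = A" using closed by (intro orbit) auto
      then have "A \<subseteq> B" by blast
      then have "\<sigma>' b \<in> B" using b B(3) by blast
      then have "a \<in> B" by (simp add: \<sigma>'_def)
      then show ?thesis using B \<open>A \<subseteq> B\<close> by blast
    qed
    ultimately show ?thesis
      unfolding cyclic_permutation_def by blast
  qed
qed

lemma cyclic_permutation_leaves: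
  assumes "cyclic_permutation A \<sigma>" "B \<noteq> {}" "B \<subset> A"
  obtains x where "x \<in> B" "\<sigma> x \<in> A - B"
proof -
  have "\<not> \<sigma> ` B \<subseteq> B" using assms by (auto simp: cyclic_permutation_def)
  then obtain x where "x \<in> B" "\<sigma> x \<notin> B" by blast
  moreover have "\<sigma> x \<in> A" using assms \<open>x \<in> B\<close> by (auto simp: cyclic_permutation_def bij_betw_def)
  ultimately show thesis using that by blast
qed

text \<open>
  Each vertex \<open>v\<close> is replaced by a cycle through the ends \<open>(v, e)\<close> of the edges at \<open>v\<close>;
  \<open>Inr (v, e)\<close> names the cycle edge from \<open>(v, e)\<close> to its successor.
\<close>

definition inflation ::
    "('v, 'e) mgraph \<Rightarrow> ('v \<Rightarrow> 'e \<Rightarrow> 'e) \<Rightarrow> ('v \<times> 'e, 'e + 'v \<times> 'e) mgraph" where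
  "inflation G \<sigma> =
    \<lparr>vertices = Sigma (vertices G) (star G),
     edges = edges G <+> Sigma (vertices G) (star G),
     ends = case_sum (\<lambda>e. ends G e \<times> {e}) (\<lambda>(v, e). {(v, e), (v, \<sigma> v e)})\<rparr>"

lemma inflation_simps [simp]:
  "vertices (inflation G \<sigma>) = Sigma (vertices G) (star G)"
  "edges (inflation G \<sigma>) = edges G <+> Sigma (vertices G) (star G)"
  "ends (inflation G \<sigma>) (Inl e) = ends G e \<times> {e}"
  "ends (inflation G \<sigma>) (Inr (v, e)) = {(v, e), (v, \<sigma> v e)}"
  by (simp_all add: inflation_def)

lemma (in multigraph) cut_edges_singleton: "cut_edges G {v} = star G v"
  by (auto simp: cut_edges_def star_def Int_insert_right)

text \<open>A fixed point of \<open>\<sigma> v\<close> would make \<open>v\<close> a vertex of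
  degree one, against 2-edge-connectivity. Each new vertex lies on one edge of \<open>G\<close> and
  on the cycle edges to its successor and from its predecessor; at a vertex of degree two these are
  parallel but have different names. A cut that splits some cycle contains two of its edges, and any
  other cut contains a cut of \<open>G\<close>.\<close>

lemma (in multigraph) inflation_properties:
  assumes conn: "k_edge_connected 2 G"
    and cyc: "\<And>v. cyclic_permutation (star G v) (\<sigma> v)"
  shows "multigraph (inflation G \<sigma>)" and "cubic (inflation G \<sigma>)"
    and "k_edge_connected 2 (inflation G \<sigma>)"
    and "v \<in> vertices G \<Longrightarrow> e \<in> star G v \<Longrightarrow> \<sigma> v e \<noteq> e"
proof -
  let ?H = "inflation G \<sigma>"
  have fin_star: "finite (star G v)" for v using finite_edges by (simp add: star_def)
  have bij: "bij_betw (\<sigma> v) (star G v) (star G v)" for v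
    using cyc by (simp add: cyclic_permutation_def)
  have \<sigma>_star: "\<sigma> v e \<in> star G v" if "e \<in> star G v" for v e
    using bij that by (auto simp: bij_betw_def)
  have moves: "\<sigma> v e \<noteq> e" if v: "v \<in> vertices G" and e: "e \<in> star G v" for v e
  proof
    assume fix_e: "\<sigma> v e = e"
    have "{e} = star G v"
      using cyc[of v] e fix_e unfolding cyclic_permutation_def by blast
    then have "card (cut_edges G {v}) = 1" by (metis cut_edges_singleton is_singletonI is_singleton_altdef)
    moreover have "{v} \<subset> vertices G"
    proof -
      have "card (ends G e) = 2" "ends G e \<subseteq> vertices G"
        using e card_ends ends_subset by (auto simp: star_def)
      then have "\<not> vertices G \<subseteq> {v}"
        using card_mono[of "{v}" "ends G e"] by fastforce
      then show ?thesis using v by blast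
    qed
    ultimately show False using conn by (force simp: k_edge_connected_def)
  qed
  then show "v \<in> vertices G \<Longrightarrow> e \<in> star G v \<Longrightarrow> \<sigma> v e \<noteq> e" .
  show mg: "multigraph ?H"
  proof
    show "finite (vertices ?H)" "finite (edges ?H)"
      using finite_vertices finite_edges fin_star by (auto intro: finite_SigmaI finite_Plus)
    fix x assume x: "x \<in> edges ?H"
    show "ends ?H x \<subseteq> vertices ?H"
      using x ends_subset \<sigma>_star by (cases x) (auto simp: star_def)
    show "card (ends ?H x) = 2"
      using x moves[symmetric] card_ends
      by (cases x) (auto simp: card_cartesian_product card_insert_if)
  qed
  show "cubic ?H"
    unfolding cubic_def
  proof
    fix y assume "y \<in> vertices ?H"
    then obtain v e where y: "y = (v, e)" and v: "v \<in> vertices G" and e: "e \<in> star G v" by auto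
    from bij[of v] e obtain e' where e': "e' \<in> star G v" "\<sigma> v e' = e"
      by (metis bij_betw_imp_surj_on imageE)
    have unique: "x = e'" if "x \<in> star G v" "\<sigma> v x = e" for x
      using bij[of v] that e' by (metis bij_betw_def inj_onD)
    have "e' \<noteq> e" using moves v e' by blast
    have "{x \<in> edges ?H. y \<in> ends ?H x} = {Inl e, Inr (v, e), Inr (v, e')}" (is "?L = ?R")
    proof
      show "?L \<subseteq> ?R" using y unique by auto
      show "?R \<subseteq> ?L" using y v e e' by (auto simp: star_def)
    qed
    then show "degree ?H y = 3" using \<open>e' \<noteq> e\<close> by (simp add: degree_def)
  qed
  show "k_edge_connected 2 ?H"
    unfolding k_edge_connected_def
  proof (intro allI impI)
    fix X assume X: "X \<noteq> {} \<and> X \<subset> vertices ?H"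
    have fin_cut: "finite (cut_edges ?H X)"
      using multigraph.finite_edges[OF mg] by (simp add: cut_edges_def)
    show "2 \<le> card (cut_edges ?H X)"
    proof (cases "\<exists>v e e'. (v, e) \<in> X \<and> (v, e') \<in> vertices ?H - X")
      case True
      then obtain v e e' where v: "(v, e) \<in> X" "(v, e') \<in> vertices ?H - X" by blast
      define B where "B = {x \<in> star G v. (v, x) \<in> X}"
      have "e \<in> B" "e' \<in> star G v - B" "v \<in> vertices G" using v X by (auto simp: B_def)
      then have "B \<noteq> {}" and "B \<subset> star G v" and "star G v - B \<noteq> {}" and "star G v - B \<subset> star G v"
        by (auto simp: B_def)
      obtain x where x: "x \<in> B" "\<sigma> v x \<in> star G v - B"
        by (rule cyclic_permutation_leaves[OF cyc \<open>B \<noteq> {}\<close> \<open>B \<subset> star G v\<close>])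
      \<comment> \<open>Leaving the complement of \<open>B\<close> means that the cycle returns to
        \<open>B\<close>, which gives a second cut edge.\<close>
      obtain x' where x': "x' \<in> star G v - B" "\<sigma> v x' \<in> star G v - (star G v - B)"
        by (rule cyclic_permutation_leaves[OF cyc \<open>star G v - B \<noteq> {}\<close> \<open>star G v - B \<subset> star G v\<close>])
      have x_cut: "{(v, x), (v, \<sigma> v x)} \<inter> X = {(v, x)}" using x by (auto simp: B_def)
      have x'_cut: "{(v, x'), (v, \<sigma> v x')} \<inter> X = {(v, \<sigma> v x')}" using x' by (auto simp: B_def)
      have "{Inr (v, x), Inr (v, x')} \<subseteq> cut_edges ?H X"
        using x x' \<open>v \<in> vertices G\<close> x_cut x'_cut by (auto simp: cut_edges_def B_def)
      moreover have "x \<noteq> x'" using x x' by blast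
      then have "card {Inr (v, x) :: 'e + 'v \<times> 'e, Inr (v, x')} = 2" by simp
      ultimately show ?thesis by (metis card_mono fin_cut)
    next
      case False
      \<comment> \<open>Here \<open>X\<close> is a union of whole cycles, those of the vertices in
        \<open>Y\<close>.\<close>
      define Y where "Y = fst ` X"
      have blocks: "(v, e) \<in> X \<longleftrightarrow> v \<in> Y" if "v \<in> vertices G" "e \<in> star G v" for v e
        using False that by (force simp: Y_def)
      have "Y \<noteq> {}" using X by (auto simp: Y_def)
      moreover from X obtain w where w: "w \<in> vertices ?H - X" by auto
      then have "fst w \<notin> Y" using blocks by (cases w) auto
      then have "Y \<subset> vertices G" using w X by (fastforce simp: Y_def)
      ultimately have two: "2 \<le> card (cut_edges G Y)" using conn by (simp add: k_edge_connected_def)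
      have "(Inl ` cut_edges G Y :: ('e + 'v \<times> 'e) set) \<subseteq> cut_edges ?H X"
      proof
        fix x :: "'e + 'v \<times> 'e" assume "x \<in> Inl ` cut_edges G Y"
        then obtain e where e: "x = Inl e" "e \<in> edges G" "card (ends G e \<inter> Y) = 1"
          by (auto simp: cut_edges_def)
        have "(ends G e \<times> {e}) \<inter> X = (ends G e \<inter> Y) \<times> {e}"
          using blocks e(2) ends_subset[OF e(2)] by (auto simp: star_def)
        then show "x \<in> cut_edges ?H X"
          using e by (auto simp: cut_edges_def card_cartesian_product)
      qed
      then have "card (cut_edges G Y) \<le> card (cut_edges ?H X)"
        by (metis card_image card_mono fin_cut inj_Inl)
      with two show ?thesis by linarith
    qed
  qed
qed

section \<open>Even subgraphs from perfect matchings\<close>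

text \<open>Each vertex has degree 3 - 1 = 2 in the complement, so after swapping the sums every
  value of \<open>\<psi>\<close> is counted twice.\<close>

lemma (in multigraph) perfect_matching_complement_even:
  fixes \<psi> :: "'v \<Rightarrow> int"
  assumes "cubic G" "perfect_matching G M"
  shows "even (\<Sum>x\<in>edges G - M. \<Sum>y\<in>ends G x. \<psi> y)"
proof -
  have deg: "card {x \<in> edges G - M. y \<in> ends G x} = 2" if y: "y \<in> vertices G" for y
  proof -
    obtain m where m: "m \<in> M" "y \<in> ends G m" "\<And>x. x \<in> M \<Longrightarrow> y \<in> ends G x \<Longrightarrow> x = m"
      using assms(2) y unfolding perfect_matching_def by blast
    then have "{x \<in> edges G - M. y \<in> ends G x} = {x \<in> edges G. y \<in> ends G x} - {m}" by blast
    moreover have "m \<in> edges G" using m(1) assms(2) unfolding perfect_matching_def by blast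
    moreover have "card {x \<in> edges G. y \<in> ends G x} = 3"
      using assms(1) y by (simp add: cubic_def degree_def)
    ultimately show ?thesis using m(1,2) by simp
  qed
  have "(\<Sum>x\<in>edges G - M. \<Sum>y\<in>ends G x. \<psi> y) =
      (\<Sum>x\<in>edges G - M. \<Sum>y | y \<in> vertices G \<and> y \<in> ends G x. \<psi> y)"
  proof (rule sum.cong)
    fix x assume "x \<in> edges G - M"
    then have "{y \<in> vertices G. y \<in> ends G x} = ends G x" using ends_subset by auto
    then show "sum \<psi> (ends G x) = (\<Sum>y | y \<in> vertices G \<and> y \<in> ends G x. \<psi> y)" by simp
  qed simp
  also have "\<dots> = (\<Sum>y\<in>vertices G. \<Sum>x | x \<in> edges G - M \<and> y \<in> ends G x. \<psi> y)"
    by (rule sum.swap_restrict) (simp_all add: finite_vertices finite_edges)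
  also have "\<dots> = (\<Sum>y\<in>vertices G. 2 * \<psi> y)"
    using deg by (intro sum.cong) auto
  finally show ?thesis by (simp add: sum_distrib_left[symmetric])
qed

text \<open>A potential on \<open>G\<close> is lifted to the inflation by \<open>fst\<close>, hence
  is constant on each cycle. The cycle edges then contribute even amounts, which leaves the edges of
  \<open>G\<close>; their sums and differences of end values agree modulo 2.\<close>

lemma (in multigraph) six_even_subgraphs:
  fixes t h :: "'e \<Rightarrow> 'v"
  assumes berge_fulkerson:
      "\<And>H :: (nat, nat) mgraph.
        multigraph H \<Longrightarrow> cubic H \<Longrightarrow> k_edge_connected 2 H \<Longrightarrow> has_berge_fulkerson_cover H"
    and conn: "k_edge_connected 2 G"
    and th: "\<And>e. e \<in> edges G \<Longrightarrow> ends G e = {t e, h e}"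
  obtains M :: "nat \<Rightarrow> 'e set"
  where "\<And>i (\<phi> :: 'v \<Rightarrow> int). i < 6 \<Longrightarrow> even (\<Sum>e\<in>edges G - M i. \<phi> (h e) - \<phi> (t e))"
    and "\<And>e. e \<in> edges G \<Longrightarrow> card {i. i < 6 \<and> e \<in> M i} = 2"
proof -
  have "finite (star G v)" for v using finite_edges by (simp add: star_def)
  then have "\<forall>v. \<exists>\<sigma>. cyclic_permutation (star G v) \<sigma>"
    using cyclic_permutation_exists by blast
  then obtain \<sigma> where \<sigma>: "\<And>v. cyclic_permutation (star G v) (\<sigma> v)"
    by metis
  let ?H = "inflation G \<sigma>"
  note H = inflation_properties[OF conn \<sigma>]
  have "has_berge_fulkerson_cover ?H"
    by (rule berge_fulkerson_any_type[OF _ H(1-3)]) (rule berge_fulkerson)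
  then obtain M :: "nat \<Rightarrow> ('e + 'v \<times> 'e) set"
    where pm: "\<forall>i<6. perfect_matching ?H (M i)"
      and two: "\<forall>e\<in>edges ?H. card {i. i < 6 \<and> e \<in> M i} = 2"
    unfolding has_berge_fulkerson_cover_def by blast
  have "even (\<Sum>e\<in>edges G - Inl -` M i. \<phi> (h e) - \<phi> (t e))"
    if "i < 6" for i and \<phi> :: "'v \<Rightarrow> int"
  proof -
    let ?g = "\<lambda>x. \<Sum>y\<in>ends ?H x. \<phi> (fst y)"
    define A where "A = edges G - Inl -` M i"
    define B where "B = Sigma (vertices G) (star G) - Inr -` M i"
    have fin: "finite A" "finite B"
      using finite_edges finite_vertices by (auto simp: A_def B_def star_def)
    have split: "edges ?H - M i = A <+> B" by (auto simp: A_def B_def)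
    have Inl: "?g (Inl e) = \<phi> (h e) + \<phi> (t e)" if "e \<in> A" for e
    proof -
      have e: "e \<in> edges G" using that by (simp add: A_def)
      then have "t e \<noteq> h e" using th[of e] card_ends[of e] by auto
      moreover have "ends ?H (Inl e) = {(t e, e), (h e, e)}" using e th by auto
      ultimately show ?thesis by simp
    qed
    have Inr: "even (?g (Inr y))" if "y \<in> B" for y
    proof -
      obtain v e where y: "y = (v, e)" by (cases y)
      then have "v \<in> vertices G" "e \<in> star G v" using that by (simp_all add: B_def)
      \<comment> \<open>As \<open>\<sigma> v e\<close> differs from \<open>e\<close>, the set of
        ends has two elements and its sum is \<open>2 * \<phi> v\<close>, not
        \<open>\<phi> v\<close>.\<close>
      with H(4)[of v e] y show ?thesis by (simp add: eq_commute)
    qed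
    have "even (\<Sum>x\<in>A <+> B. ?g x)"
      using multigraph.perfect_matching_complement_even[OF H(1,2), of "M i" "\<lambda>y. \<phi> (fst y)"]
        pm that by (simp only: split)
    also have "(\<Sum>x\<in>A <+> B. ?g x) = (\<Sum>e\<in>A. ?g (Inl e)) + (\<Sum>y\<in>B. ?g (Inr y))"
      using fin by (simp add: sum.Plus)
    finally have "even (\<Sum>e\<in>A. ?g (Inl e))" using Inr by (simp add: dvd_sum)
    also have "(\<Sum>e\<in>A. ?g (Inl e)) = (\<Sum>e\<in>A. \<phi> (h e) + \<phi> (t e))"
      using Inl by (intro sum.cong) auto
    also have "\<dots> = (\<Sum>e\<in>A. \<phi> (h e) - \<phi> (t e)) + 2 * (\<Sum>e\<in>A. \<phi> (t e))"
      by (simp only: sum_distrib_left flip: sum.distrib) (simp add: algebra_simps)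
    finally show ?thesis by (simp add: A_def)
  qed
  moreover have "card {i. i < 6 \<and> e \<in> Inl -` M i} = 2" if "e \<in> edges G" for e
    using two that by auto
  ultimately show thesis by (intro that[of "\<lambda>i. Inl -` M i"])
qed

section \<open>Cuts, flows and deletable arcs\<close>

lemma (in multigraph) cut_edges_eq:
  assumes "\<And>e. e \<in> edges G \<Longrightarrow> ends G e = {t e, h e}"
  shows "cut_edges G X = {e \<in> edges G. (t e \<in> X) \<noteq> (h e \<in> X)}"
proof -
  have "card (ends G e \<inter> X) = 1 \<longleftrightarrow> (t e \<in> X) \<noteq> (h e \<in> X)" if e: "e \<in> edges G" for e
  proof -
    have "t e \<noteq> h e" using assms[OF e] card_ends[OF e] by auto
    then show ?thesis using assms[OF e] by (auto simp: Int_insert_left)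
  qed
  then show ?thesis by (auto simp: cut_edges_def)
qed

text \<open>For the indicator of \<open>X\<close>, an edge of \<open>C\<close> contributes plus or
  minus 1 if it crosses the cut and 0 otherwise.\<close>

lemma (in multigraph) even_card_cut:
  fixes t h :: "'e \<Rightarrow> 'v"
  assumes th: "\<And>e. e \<in> edges G \<Longrightarrow> ends G e = {t e, h e}"
    and C: "C \<subseteq> edges G"
    and even: "\<And>\<phi> :: 'v \<Rightarrow> int. even (\<Sum>e\<in>C. \<phi> (h e) - \<phi> (t e))"
  shows "even (card (cut_edges G X \<inter> C))"
proof -
  define \<phi> :: "'v \<Rightarrow> int" where "\<phi> = (\<lambda>v. of_bool (v \<in> X))"
  have fin: "finite C" using C finite_edges finite_subset by blast
  have "int (card (cut_edges G X \<inter> C)) = (\<Sum>e\<in>C. of_bool (e \<in> cut_edges G X))"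
    using fin by (simp add: Int_commute Int_def)
  moreover have "even ((\<Sum>e\<in>C. of_bool (e \<in> cut_edges G X)) - (\<Sum>e\<in>C. \<phi> (h e) - \<phi> (t e)))"
    unfolding sum_subtractf[symmetric, of "\<lambda>e. of_bool (e \<in> cut_edges G X)"]
    using C by (intro dvd_sum) (auto simp: \<phi>_def cut_edges_eq[OF th])
  ultimately have "even (int (card (cut_edges G X \<inter> C)))" using even[of \<phi>] by simp
  then show ?thesis by simp
qed

text \<open>Arcs point along the flow. If no arc other than \<open>e\<close> left \<open>X\<close>,
  all other cut edges would carry their full weight into \<open>X\<close>, and \<open>e\<close> is
  too light to carry that amount out.\<close>

lemma (in multigraph) strong_del_arc_of_flow:
  fixes t h :: "'e \<Rightarrow> 'v" and F :: "'e \<Rightarrow> int"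
  assumes th: "\<And>e. e \<in> edges G \<Longrightarrow> ends G e = {t e, h e}"
    and flow: "\<And>\<phi> :: 'v \<Rightarrow> int. (\<Sum>a\<in>edges G. F a * (\<phi> (h a) - \<phi> (t a))) = 0"
    and e: "e \<in> edges G"
    and light: "\<And>X. X \<noteq> {} \<Longrightarrow> X \<subset> vertices G \<Longrightarrow> \<bar>F e\<bar> < (\<Sum>a\<in>cut_edges G X - {e}. \<bar>F a\<bar>)"
  shows "strong (pre_digraph.del_arc
    \<lparr>verts = vertices G, arcs = edges G,
     tail = \<lambda>a. if F a > 0 then t a else h a, head = \<lambda>a. if F a > 0 then h a else t a\<rparr> e)"
    (is "strong ?D")
  unfolding strong_def
proof (intro allI impI)
  fix X assume "X \<noteq> {} \<and> X \<subset> verts ?D"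
  then have X: "X \<noteq> {}" "X \<subset> vertices G" by (simp_all add: pre_digraph.del_arc_def)
  define \<phi> :: "'v \<Rightarrow> int" where "\<phi> = (\<lambda>v. of_bool (v \<in> X))"
  show "\<exists>a\<in>arcs ?D. tail ?D a \<in> X \<and> head ?D a \<in> verts ?D - X"
  proof (rule ccontr)
    assume no: "\<not> ?thesis"
    \<comment> \<open>With \<open>\<phi>\<close> the indicator of \<open>X\<close>, the left side is
      the net amount that \<open>a\<close> brings into \<open>X\<close>.\<close>
    have enter: "F a * (\<phi> (h a) - \<phi> (t a)) = (if a \<in> cut_edges G X then \<bar>F a\<bar> else 0)"
      if a: "a \<in> edges G - {e}" for a
    proof -
      have "t a \<in> vertices G" "h a \<in> vertices G" using a th ends_subset by auto
      moreover have "\<not> (tail ?D a \<in> X \<and> head ?D a \<in> verts ?D - X)"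
        using no a by (auto simp: pre_digraph.del_arc_def)
      ultimately show ?thesis
        using a X by (auto simp: pre_digraph.del_arc_def \<phi>_def cut_edges_eq[OF th] split: if_splits)
    qed
    have "(\<Sum>a\<in>edges G - {e}. F a * (\<phi> (h a) - \<phi> (t a))) =
        (\<Sum>a\<in>edges G - {e}. if a \<in> cut_edges G X then \<bar>F a\<bar> else 0)"
      by (rule sum.cong[OF refl]) (rule enter)
    also have "\<dots> = (\<Sum>a\<in>(edges G - {e}) \<inter> cut_edges G X. \<bar>F a\<bar>)"
      using finite_edges by (simp add: sum.inter_restrict)
    also have "(edges G - {e}) \<inter> cut_edges G X = cut_edges G X - {e}"
      by (auto simp: cut_edges_def)
    finally have "F e * (\<phi> (h e) - \<phi> (t e)) + (\<Sum>a\<in>cut_edges G X - {e}. \<bar>F a\<bar>) = 0"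
      using flow[of \<phi>] sum.remove[OF finite_edges e, of "\<lambda>a. F a * (\<phi> (h a) - \<phi> (t a))"] by simp
    moreover have "F e * (\<phi> (h e) - \<phi> (t e)) \<ge> - \<bar>F e\<bar>"
      by (auto simp: \<phi>_def)
    ultimately show False using light[OF X] by linarith
  qed
qed

lemma even_sum_symmetric_difference:
  fixes f :: "'a \<Rightarrow> int"
  assumes "finite A" "finite B" "even (sum f A)" "even (sum f B)"
  shows "even (sum f (A - B \<union> (B - A)))"
proof -
  have "sum f (A - B \<union> (B - A)) = sum f (A - B) + sum f (B - A)"
    using assms by (intro sum.union_disjoint) auto
  also have "\<dots> = sum f A + sum f B - 2 * sum f (A \<inter> B)"
    using assms by (simp add: sum.Int_Diff[of A f B] sum.Int_Diff[of B f A] Int_commute)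
  finally show ?thesis using assms by simp
qed

text \<open>
  The matchings meet the cut \<open>2 \<cdot> 3\<close> times in total, and each of them meets it an odd number
  of times.
\<close>

lemma (in multigraph) three_edge_cut_meets_matching_once:
  fixes t h :: "'e \<Rightarrow> 'v" and M :: "nat \<Rightarrow> 'e set"
  assumes th: "\<And>e. e \<in> edges G \<Longrightarrow> ends G e = {t e, h e}"
    and even: "\<And>i (\<phi> :: 'v \<Rightarrow> int). i < 6 \<Longrightarrow> even (\<Sum>e\<in>edges G - M i. \<phi> (h e) - \<phi> (t e))"
    and two: "\<And>e. e \<in> edges G \<Longrightarrow> card {i. i < 6 \<and> e \<in> M i} = 2"
    and cut: "card (cut_edges G X) = 3"
    and i: "i < 6"
  shows "card (cut_edges G X \<inter> M i) = 1"
proof -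
  let ?X = "cut_edges G X"
  have fin: "finite ?X" using cut card.infinite by fastforce
  \<comment> \<open>An even number of the three cut edges lies outside \<open>M j\<close>, so not
    all of them do. Six sets with at least one edge each and a total of 6 have exactly one
    each.\<close>
  have pos: "1 \<le> card (?X \<inter> M j)" if "j < 6" for j
  proof -
    have "even (card (?X \<inter> (edges G - M j)))"
      using even_card_cut[OF th _ even[OF that]] by blast
    moreover have "?X \<inter> (edges G - M j) = ?X - M j" by (auto simp: cut_edges_def)
    ultimately have "card (?X - M j) \<noteq> 3" by auto
    then show ?thesis using card_Int_Diff[OF fin, of "M j"] cut by linarith
  qed
  have "(\<Sum>j<6. card (?X \<inter> M j)) = (\<Sum>j<6. \<Sum>e\<in>?X. of_bool (e \<in> M j))"
    using fin by (simp add: Int_def)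
  also have "\<dots> = (\<Sum>e\<in>?X. \<Sum>j<6. of_bool (e \<in> M j))" by (rule sum.swap)
  also have "\<dots> = (\<Sum>e\<in>?X. 2)"
  proof (rule sum.cong)
    fix e assume "e \<in> ?X"
    then have "card {j. j < 6 \<and> e \<in> M j} = 2" using two by (simp add: cut_edges_def)
    moreover have "{..<6} \<inter> {j. e \<in> M j} = {j. j < 6 \<and> e \<in> M j}" by auto
    ultimately show "(\<Sum>j<6. of_bool (e \<in> M j)) = (2 :: nat)" by simp
  qed simp
  finally have "(\<Sum>j<6. card (?X \<inter> M j)) = 6" using cut by simp
  moreover have "(\<Sum>j<6. card (?X \<inter> M j)) =
      card (?X \<inter> M i) + (\<Sum>j\<in>{..<6} - {i}. card (?X \<inter> M j))"
    using i sum.remove[of "{..<6}" i "\<lambda>j. card (?X \<inter> M j)"] by simp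
  moreover have "(\<Sum>j\<in>{..<6} - {i}. card (?X \<inter> M j)) \<ge> (\<Sum>j\<in>{..<6} - {i}. 1)"
    using pos by (intro sum_mono) auto
  moreover have "(\<Sum>j\<in>{..<6} - {i}. 1) = (5 :: nat)" using i by simp
  ultimately show ?thesis using pos[OF i] by linarith
qed

section \<open>The five orientations\<close>

theorem theorem3:
  fixes G :: "('v, 'e) mgraph"
  assumes berge_fulkerson:
      "\<And>H :: (nat, nat) mgraph.
        multigraph H \<Longrightarrow> cubic H \<Longrightarrow> k_edge_connected 2 H \<Longrightarrow> has_berge_fulkerson_cover H"
    and "multigraph G"
    and "k_edge_connected 3 G"
  shows "frank_number G \<le> 5"
proof -
  interpret multigraph G by (rule assms(2))
  let ?E = "edges G"
  have "\<forall>e\<in>?E. \<exists>a b. ends G e = {a, b}" using card_ends by (meson card_2_iff)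
  \<comment> \<open>This fixes an arbitrary reference direction, which the sign of a flow keeps or
    reverses.\<close>
  then obtain t h :: "'e \<Rightarrow> 'v" where th: "\<And>e. e \<in> ?E \<Longrightarrow> ends G e = {t e, h e}" by metis
  have conn: "3 \<le> card (cut_edges G X)" if "X \<noteq> {}" "X \<subset> vertices G" for X
    using assms(3) that by (simp add: k_edge_connected_def)
  have conn2: "k_edge_connected 2 G"
    unfolding k_edge_connected_def
  proof (intro allI impI)
    fix X assume "X \<noteq> {} \<and> X \<subset> vertices G"
    then have "3 \<le> card (cut_edges G X)" using conn by blast
    then show "2 \<le> card (cut_edges G X)" by simp
  qed
  obtain M :: "nat \<Rightarrow> 'e set"
    where even: "\<And>i (\<phi> :: 'v \<Rightarrow> int). i < 6 \<Longrightarrow> even (\<Sum>e\<in>?E - M i. \<phi> (h e) - \<phi> (t e))"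
      and two: "\<And>e. e \<in> ?E \<Longrightarrow> card {i. i < 6 \<and> e \<in> M i} = 2"
  proof (rule six_even_subgraphs[OF _ conn2 th])
    show "has_berge_fulkerson_cover H"
      if "multigraph H" "cubic H" "k_edge_connected 2 H" for H :: "(nat, nat) mgraph"
      using that by (rule berge_fulkerson)
  qed (assumption, rule that)
  define C where "C i = ?E - M i" for i
  \<comment> \<open>Conservation is summed over all of \<open>?E\<close>, so that flows with
    different supports can be added.\<close>
  define flow_on :: "'e set \<Rightarrow> ('e \<Rightarrow> int) \<Rightarrow> bool" where
    "flow_on A s \<longleftrightarrow> (\<forall>e\<in>A. \<bar>s e\<bar> = 1) \<and> (\<forall>e. e \<notin> A \<longrightarrow> s e = 0) \<and>
      (\<forall>\<phi> :: 'v \<Rightarrow> int. (\<Sum>e\<in>?E. s e * (\<phi> (h e) - \<phi> (t e))) = 0)" for A s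
  have flow_exists: "\<exists>s. flow_on A s"
    if A: "A \<subseteq> ?E" and ev: "\<And>\<phi> :: 'v \<Rightarrow> int. even (\<Sum>e\<in>A. \<phi> (h e) - \<phi> (t e))" for A
  proof -
    obtain s :: "'e \<Rightarrow> int" where s: "\<And>e. e \<in> A \<Longrightarrow> \<bar>s e\<bar> = 1" "\<And>e. e \<notin> A \<Longrightarrow> s e = 0"
      "\<And>\<phi> :: 'v \<Rightarrow> int. (\<Sum>e\<in>A. s e * (\<phi> (h e) - \<phi> (t e))) = 0"
      by (rule eulerian_signs[where C = A and t = t and h = h, OF finite_subset[OF A finite_edges] ev])
        (rule that)
    have "(\<Sum>e\<in>?E. s e * (\<phi> (h e) - \<phi> (t e))) = (\<Sum>e\<in>A. s e * (\<phi> (h e) - \<phi> (t e)))"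
      for \<phi> :: "'v \<Rightarrow> int"
      using A s(2) finite_edges by (intro sum.mono_neutral_right) auto
    then show ?thesis using s by (auto simp: flow_on_def)
  qed
  \<comment> \<open>The first five indices form a cycle; index 5 stays outside it and is shared by
    all five flows.\<close>
  define next5 :: "nat \<Rightarrow> nat" where "next5 i = (if i = 4 then 0 else i + 1)" for i
  have next5: "next5 i < 5" "next5 i \<noteq> i" "next5 (next5 i) \<noteq> i" if "i < 5" for i
    using that by (auto simp: next5_def split: if_splits)
  have "\<forall>i. \<exists>s. i < 6 \<longrightarrow> flow_on (C i) s"
    using flow_exists[of "C _"] even by (auto simp: C_def)
  then obtain s where s: "\<And>i. i < 6 \<Longrightarrow> flow_on (C i) (s i)" by metis
  let ?P = "\<lambda>i. C (next5 i) - C 5 \<union> (C 5 - C (next5 i))"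
  have "\<forall>i. \<exists>p. i < 5 \<longrightarrow> flow_on (?P i) p"
  proof (intro allI)
    fix i
    show "\<exists>p. i < 5 \<longrightarrow> flow_on (?P i) p"
    proof (cases "i < 5")
      case True
      then have "next5 i < 6" using next5(1) by fastforce
      then have "\<exists>p. flow_on (?P i) p"
        using even finite_edges
        by (intro flow_exists even_sum_symmetric_difference) (auto simp: C_def)
      then show ?thesis by blast
    qed simp
  qed
  then obtain p where p: "\<And>i. i < 5 \<Longrightarrow> flow_on (?P i) (p i)" by metis
  txt \<open>The factor 5 forces \<open>\<bar>F i e\<bar> \<ge> 2\<close> outside \<open>M i\<close>, because \<open>\<bar>s 5 e + 2 * p i e\<bar> \<le> 3\<close>.\<close>
  define F where "F i e = s 5 e + 2 * p i e + 5 * s i e" for i e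
  have flow: "(\<Sum>e\<in>?E. F i e * (\<phi> (h e) - \<phi> (t e))) = 0" if "i < 5" for i and \<phi> :: "'v \<Rightarrow> int"
  proof -
    have "(\<Sum>e\<in>?E. F i e * (\<phi> (h e) - \<phi> (t e))) =
        (\<Sum>e\<in>?E. s 5 e * (\<phi> (h e) - \<phi> (t e))) +
        2 * (\<Sum>e\<in>?E. p i e * (\<phi> (h e) - \<phi> (t e))) +
        5 * (\<Sum>e\<in>?E. s i e * (\<phi> (h e) - \<phi> (t e)))"
      by (simp only: F_def distrib_right sum.distrib sum_distrib_left mult.assoc)
    then show ?thesis
      using s[of 5] s[of i] p[of i] that by (simp add: flow_on_def)
  qed
  have at_most_two: False
    if "e \<in> ?E" "i < 5" "e \<in> M i" "e \<in> M (next5 i)" "e \<in> M 5" for e i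
  proof -
    have "{i, next5 i, 5} \<subseteq> {j. j < 6 \<and> e \<in> M j}" using that next5(1)[of i] by auto
    then have "card {i, next5 i, 5} \<le> 2"
      unfolding two[OF that(1), symmetric] by (rule card_mono[rotated]) simp
    then show False using that next5[of i] by simp
  qed
  have bound: "\<bar>g e\<bar> \<le> 1" if "flow_on A g" for A g e
    using that by (cases "e \<in> A") (auto simp: flow_on_def)
  have F_outside: "\<bar>F i e\<bar> \<ge> 2" if "i < 5" "e \<in> ?E" "e \<notin> M i" for i e
  proof -
    have "\<bar>s i e\<bar> = 1" using s[of i] that by (auto simp: flow_on_def C_def)
    moreover have "\<bar>s 5 e\<bar> \<le> 1" "\<bar>p i e\<bar> \<le> 1"
      using bound[OF s[of 5]] bound[OF p[OF that(1)]] by simp_all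
    ultimately show ?thesis unfolding F_def by linarith
  qed
  \<comment> \<open>On \<open>M i\<close> only \<open>s 5 e + 2 * p i e\<close> remains. In
    \<open>M 5\<close>, \<open>s 5 e\<close> is 0 and \<open>e\<close> avoids
    \<open>M (next5 i)\<close>, so \<open>p i e\<close> is plus or minus 1 and the absolute value is
    2. Outside \<open>M 5\<close> the value is odd, hence nonzero; if \<open>e\<close> also avoids
    \<open>M (next5 i)\<close>, then \<open>p i e\<close> is 0 and the absolute value is 1.\<close>
  have F_inside: "F i e \<noteq> 0 \<and> (e \<notin> M (next5 i) \<longrightarrow> \<bar>F i e\<bar> \<le> 2)"
    if i: "i < 5" and e: "e \<in> ?E" "e \<in> M i" for i e
  proof -
    have si: "s i e = 0" using s[of i] that by (auto simp: flow_on_def C_def)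
    show ?thesis
    proof (cases "e \<in> M 5")
      case True
      then have "e \<notin> M (next5 i)" using at_most_two that by blast
      then have "\<bar>p i e\<bar> = 1" using p[OF i] e True by (auto simp: flow_on_def C_def)
      moreover have "s 5 e = 0" using s[of 5] True by (auto simp: flow_on_def C_def)
      ultimately show ?thesis using si by (auto simp: F_def)
    next
      case False
      then have s5: "\<bar>s 5 e\<bar> = 1" using s[of 5] e by (auto simp: flow_on_def C_def)
      then have "F i e \<noteq> 0" unfolding F_def si by presburger
      moreover have "p i e = 0" if "e \<notin> M (next5 i)"
        using p[OF i] e False that by (auto simp: flow_on_def C_def)
      ultimately show ?thesis using s5 si by (auto simp: F_def)
    qed
  qed
  have nowhere_zero: "\<bar>F i e\<bar> \<ge> 1" if "i < 5" "e \<in> ?E" for i e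
    using F_inside[OF that] F_outside[OF that] by (cases "e \<in> M i") fastforce+
  define D where "D i = \<lparr>verts = vertices G, arcs = ?E,
    tail = \<lambda>a. if F i a > 0 then t a else h a, head = \<lambda>a. if F i a > 0 then h a else t a\<rparr>" for i
  have orient: "orientation G (D i)" for i
    using th by (auto simp: orientation_def D_def)
  have deletable: "strong (pre_digraph.del_arc (D i) e)"
    if i: "i < 5" and e: "e \<in> ?E" "e \<in> M i" "e \<notin> M (next5 i)" for i e
    unfolding D_def
  proof (rule strong_del_arc_of_flow[OF th flow[OF i] e(1)])
    fix X assume X: "X \<noteq> {}" "X \<subset> vertices G"
    let ?R = "cut_edges G X - {e}"
    have fin: "finite (cut_edges G X)" using finite_edges by (simp add: cut_edges_def)
    have R: "?R \<subseteq> ?E" by (auto simp: cut_edges_def)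
    have "3 \<le> (\<Sum>a\<in>?R. \<bar>F i a\<bar>)"
    proof (cases "card ?R \<ge> 3")
      case True
      have "(\<Sum>a\<in>?R. 1) \<le> (\<Sum>a\<in>?R. \<bar>F i a\<bar>)"
        using nowhere_zero[OF i] R by (intro sum_mono) auto
      then show ?thesis using True by simp
    next
      case False
      \<comment> \<open>Since every cut has at least three edges, fewer than three besides
        \<open>e\<close> force a 3-edge-cut through \<open>e\<close>. It meets \<open>M i\<close> in
        \<open>e\<close> alone, so the other two edges weigh at least 2 each.\<close>
      then have eX: "e \<in> cut_edges G X" and three: "card (cut_edges G X) = 3"
        using conn[OF X] fin by (auto simp: card_Diff_singleton_if split: if_splits)
      have "card (cut_edges G X \<inter> M i) = 1"
        using i by (intro three_edge_cut_meets_matching_once[where t = t and h = h, OF th even two three])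
          auto
      then obtain x where "cut_edges G X \<inter> M i = {x}" by (rule card_1_singletonE)
      moreover have "e \<in> cut_edges G X \<inter> M i" using eX e(2) by simp
      ultimately have "cut_edges G X \<inter> M i = {e}" by simp
      then have "a \<notin> M i" if "a \<in> ?R" for a using that by blast
      then have "(\<Sum>a\<in>?R. 2) \<le> (\<Sum>a\<in>?R. \<bar>F i a\<bar>)"
        using F_outside[OF i] R by (intro sum_mono) auto
      then show ?thesis using eX three by simp
    qed
    then show "\<bar>F i e\<bar> < (\<Sum>a\<in>?R. \<bar>F i a\<bar>)" using F_inside[OF i e(1,2)] e(3) by linarith
  qed
  have "\<exists>i<5. strong (pre_digraph.del_arc (D i) e)" if e: "e \<in> ?E" for e
  proof -
    have "\<exists>i<5. e \<in> M i \<and> e \<notin> M (next5 i)"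
    proof -
      obtain j k where jk: "{i. i < 6 \<and> e \<in> M i} = {j, k}" "j \<noteq> k"
        using two[OF e] by (meson card_2_iff)
      then have only: "i = j \<or> i = k" if "i < 6" "e \<in> M i" for i using that by blast
      \<comment> \<open>The two indices are distinct, so one of them is not 5.\<close>
      obtain i where i: "i < 5" "e \<in> M i"
      proof (cases "j = 5")
        case True
        then show thesis using jk that[of k] by force
      next
        case False
        then show thesis using jk that[of j] by force
      qed
      show ?thesis
      proof (cases "e \<in> M (next5 i)")
        case True
        \<comment> \<open>Both indices of \<open>e\<close> are used up by \<open>i\<close> and
          \<open>next5 i\<close>, and on a 5-cycle the next index differs from both. So
          \<open>next5 i\<close> is the index sought.\<close>
        have "e \<notin> M (next5 (next5 i))"
        proof
          assume in2: "e \<in> M (next5 (next5 i))"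
          let ?i' = "next5 i"
          have lt: "?i' < 5" "next5 ?i' < 5" using next5(1) i(1) by blast+
          show False
            using only[of i] only[of ?i'] only[of "next5 ?i'"] i True in2 lt
              next5(2,3)[OF i(1)] next5(2)[OF lt(1)] by force
        qed
        then show ?thesis using True next5(1)[OF i(1)] by blast
      qed (use i in blast)
    qed
    then show ?thesis using deletable e by blast
  qed
  then have "frank_number G \<le> enat 5"
    unfolding frank_number_def using orient by (intro Inf_lower) blast
  then show ?thesis by (simp add: numeral_eq_enat)
qed

end
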